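(* Assume that $\varphi$ is differentiable. Let $\mathcal{F}$ be an arbitrary class of measurable real valued functions on $\mathcal{X}$. Then for every $Q\in\mathcal{M}_{\mathcal{F}}$ such that $\phi(Q,P)$ is finite and $\varphi'\left(\frac{dQ}{dP}\right)$ belongs to $\mathcal{F}$, the $\phi$-divergence $\phi(Q,P)$ admits the dual representation $$\phi(Q,P)=\sup_{f\in\mathcal{F}}\left\{\int f\,dQ-\int\varphi^*(f)\,dP\right\},$$ and the function $\overline{f}:=\varphi'\left(\frac{dQ}{dP}\right)$ is a dual optimal solution, i.e. it attains this supremum. Furthermore, if $\varphi$ is essentially smooth, then $\overline{f}$ is the unique dual optimal solution ($P$-a.e.).
   Context: $(\mathcal{X},\mathcal{B})$ is a measurable space and $P$ a given probability measure on it. $\mathcal{M}$ is the real vector space of all signed finite measures on $(\mathcal{X},\mathcal{B})$, and $\mathcal{M}(P)$ the subspace of those absolutely continuous w.r.t. $P$. The function $\varphi:\mathbb{R}\to[0,+\infty]$ is proper, convex and closed, with $\varphi(1)=0$, and its domain $\{x:\varphi(x)<\infty\}$ is an interval with endpoints $a_\varphi<1<b_\varphi$ (finite or infinite). Closed means that $\varphi(x)\to\varphi(a_\varphi)$ as $x\downarrow a_\varphi$ if $a_\varphi$ is finite, and $\varphi(x)\to\varphi(b_\varphi)$ as $x\uparrow b_\varphi$ if $b_\varphi$ is finite (equivalently, $\varphi$ is lower semi-continuous). "Differentiable" means differentiable on $]a_\varphi,b_\varphi[$; then $\varphi'(a_\varphi)$ and $\varphi'(b_\varphi)$ denote the (finite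 or infinite) limits of $\varphi'(x)$ as $x\downarrow a_\varphi$ and $x\uparrow b_\varphi$. $\varphi$ is essentially smooth if it is differentiable with $\varphi'(a_\varphi)=-\infty$ when $a_\varphi>-\infty$ and $\varphi'(b_\varphi)=+\infty$ when $b_\varphi<+\infty$. The conjugate is $\varphi^*(t):=\sup_{x\in\mathbb{R}}\{tx-\varphi(x)\}$. For $Q\in\mathcal{M}(P)$ put $\phi(Q,P):=\int_{\mathcal{X}}\varphi\left(\frac{dQ}{dP}\right)dP$, and $\phi(Q,P):=+\infty$ if $Q\in\mathcal{M}\setminus\mathcal{M}(P)$. $\mathcal{M}_{\mathcal{F}}:=\{Q\in\mathcal{M}:\int|f|\,d|Q|<\infty\text{ for all }f\in\mathcal{F}\}$, where $|Q|$ is the total variation of $Q$. When some $Q_0\in\mathcal{M}_{\mathcal{F}}$ has $\phi(Q_0,P)<\infty$, the integral $\int\varphi^*(f)\,dP$ is well defined in $(-\infty,+\infty]$ for all $f\in\mathcal{F}$. *)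

theory Defs
  imports "HOL-Probability.Probability"
begin

definition edom :: "(real \<Rightarrow> ennreal) \<Rightarrow> real set" where
  "edom \<phi> = {x. \<phi> x < \<infinity>}"

definition dom_lo :: "(real \<Rightarrow> ennreal) \<Rightarrow> ereal" where
  "dom_lo \<phi> = (INF x\<in>edom \<phi>. ereal x)"

definition dom_hi :: "(real \<Rightarrow> ennreal) \<Rightarrow> ereal" where
  "dom_hi \<phi> = (SUP x\<in>edom \<phi>. ereal x)"

definition proper_fun :: "(real \<Rightarrow> ennreal) \<Rightarrow> bool" where
  "proper_fun \<phi> \<longleftrightarrow> edom \<phi> \<noteq> {}"

text \<open>In \<open>ennreal\<close> one has \<open>0 * \<infinity> = 0\<close>, so the cases \<open>u = 0\<close> and \<open>u = 1\<close> are trivial.\<close>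

definition econvex :: "(real \<Rightarrow> ennreal) \<Rightarrow> bool" where
  "econvex \<phi> \<longleftrightarrow> (\<forall>x y. \<forall>u\<in>{0..1}.
     \<phi> (u * x + (1 - u) * y) \<le> ennreal u * \<phi> x + ennreal (1 - u) * \<phi> y)"

definition closed_fun :: "(real \<Rightarrow> ennreal) \<Rightarrow> bool" where
  "closed_fun \<phi> \<longleftrightarrow>
     (\<forall>a. dom_lo \<phi> = ereal a \<longrightarrow> (\<phi> \<longlongrightarrow> \<phi> a) (at_right a)) \<and>
     (\<forall>b. dom_hi \<phi> = ereal b \<longrightarrow> (\<phi> \<longlongrightarrow> \<phi> b) (at_left b))"

definition divergence_fun :: "(real \<Rightarrow> ennreal) \<Rightarrow> bool" where
  "divergence_fun \<phi> \<longleftrightarrow> proper_fun \<phi> \<and> econvex \<phi> \<and> closed_fun \<phi> \<and> \<phi> 1 = 0 \<and>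
     is_interval (edom \<phi>) \<and> dom_lo \<phi> < 1 \<and> 1 < dom_hi \<phi>"

text \<open>\<open>\<phi>\<close> is finite between the endpoints of its domain, so \<open>enn2real\<close> loses nothing there.\<close>

definition differentiable_fun :: "(real \<Rightarrow> ennreal) \<Rightarrow> bool" where
  "differentiable_fun \<phi> \<longleftrightarrow>
     (\<forall>x. dom_lo \<phi> < ereal x \<and> ereal x < dom_hi \<phi> \<longrightarrow>
        (\<lambda>y. enn2real (\<phi> y)) differentiable (at x))"

text \<open>The derivative, extended to finite endpoints of the domain by its one-sided limits
  (which exist in \<open>ereal\<close> for convex differentiable \<open>\<phi>\<close>); unspecified outside
  the closure of the domain.\<close>

definition ext_deriv :: "(real \<Rightarrow> ennreal) \<Rightarrow> real \<Rightarrow> ereal" where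
  "ext_deriv \<phi> x =
     (if dom_lo \<phi> < ereal x \<and> ereal x < dom_hi \<phi> then ereal (deriv (\<lambda>y. enn2real (\<phi> y)) x)
      else if ereal x = dom_lo \<phi> then Lim (at_right x) (\<lambda>y. ereal (deriv (\<lambda>z. enn2real (\<phi> z)) y))
      else if ereal x = dom_hi \<phi> then Lim (at_left x) (\<lambda>y. ereal (deriv (\<lambda>z. enn2real (\<phi> z)) y))
      else undefined)"

definition essentially_smooth :: "(real \<Rightarrow> ennreal) \<Rightarrow> bool" where
  "essentially_smooth \<phi> \<longleftrightarrow> differentiable_fun \<phi> \<and>
     (\<forall>a. dom_lo \<phi> = ereal a \<longrightarrow> ext_deriv \<phi> a = -\<infinity>) \<and>
     (\<forall>b. dom_hi \<phi> = ereal b \<longrightarrow> ext_deriv \<phi> b = \<infinity>)"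

definition conjugate :: "(real \<Rightarrow> ennreal) \<Rightarrow> real \<Rightarrow> ereal" where
  "conjugate \<phi> t = (SUP x. ereal (t * x) - enn2ereal (\<phi> x))"

text \<open>A signed finite measure on the measurable space underlying \<open>M\<close> is a real-valued set
  function; its values off \<open>sets M\<close> are irrelevant.\<close>

definition signed_measures :: "'a measure \<Rightarrow> ('a set \<Rightarrow> real) set" where
  "signed_measures M = {Q. Q {} = 0 \<and>
     (\<forall>A :: nat \<Rightarrow> 'a set. range A \<subseteq> sets M \<longrightarrow> disjoint_family A \<longrightarrow>
        (\<lambda>i. Q (A i)) sums Q (\<Union>i. A i))}"

definition ac_signed_measures :: "'a measure \<Rightarrow> ('a set \<Rightarrow> real) set" where
  "ac_signed_measures P = {Q \<in> signed_measures P. \<forall>A\<in>null_sets P. Q A = 0}"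

text \<open>Upper and lower variation, i.e. the two parts of the Jordan decomposition.
  \<open>ennreal\<close> maps negative reals to \<open>0\<close>, which is harmless as \<open>B = {}\<close> takes part in the supremum.\<close>

definition upper_variation :: "'a measure \<Rightarrow> ('a set \<Rightarrow> real) \<Rightarrow> 'a measure" where
  "upper_variation M Q = measure_of (space M) (sets M)
     (\<lambda>A. SUP B\<in>{B \<in> sets M. B \<subseteq> A}. ennreal (Q B))"

definition lower_variation :: "'a measure \<Rightarrow> ('a set \<Rightarrow> real) \<Rightarrow> 'a measure" where
  "lower_variation M Q = upper_variation M (\<lambda>A. - Q A)"

definition total_variation :: "'a measure \<Rightarrow> ('a set \<Rightarrow> real) \<Rightarrow> 'a measure" where
  "total_variation M Q = measure_of (space M) (sets M)
     (\<lambda>A. emeasure (upper_variation M Q) A + emeasure (lower_variation M Q) A)"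

definition signed_integral :: "'a measure \<Rightarrow> ('a set \<Rightarrow> real) \<Rightarrow> ('a \<Rightarrow> real) \<Rightarrow> real" where
  "signed_integral M Q f =
     (\<integral>x. f x \<partial>upper_variation M Q) - (\<integral>x. f x \<partial>lower_variation M Q)"

text \<open>A version of \<open>dQ/dP\<close>, unique up to \<open>P\<close>-a.e. equality.\<close>

definition signed_RN_deriv :: "'a measure \<Rightarrow> ('a set \<Rightarrow> real) \<Rightarrow> 'a \<Rightarrow> real" where
  "signed_RN_deriv P Q = (SOME g. integrable P g \<and> (\<forall>A\<in>sets P. Q A = (LINT x:A|P. g x)))"

definition M_class :: "'a measure \<Rightarrow> ('a \<Rightarrow> real) set \<Rightarrow> ('a set \<Rightarrow> real) set" where
  "M_class M F =
     {Q \<in> signed_measures M. \<forall>f\<in>F. (\<integral>\<^sup>+x. ennreal \<bar>f x\<bar> \<partial>total_variation M Q) < \<infinity>}"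

definition phi_divergence ::
    "(real \<Rightarrow> ennreal) \<Rightarrow> ('a set \<Rightarrow> real) \<Rightarrow> 'a measure \<Rightarrow> ennreal" where
  "phi_divergence \<phi> Q P =
     (if Q \<in> ac_signed_measures P then \<integral>\<^sup>+x. \<phi> (signed_RN_deriv P Q x) \<partial>P else \<infinity>)"

text \<open>Integral of an extended-real-valued function as positive part minus negative part.
  It is meaningful when one of the two is finite; below, the negative part always is, so
  the \<open>ereal\<close> convention for \<open>\<infinity> - \<infinity>\<close> never matters.\<close>

definition ext_integral :: "'a measure \<Rightarrow> ('a \<Rightarrow> ereal) \<Rightarrow> ereal" where
  "ext_integral M h =
     enn2ereal (\<integral>\<^sup>+x. e2ennreal (h x) \<partial>M) - enn2ereal (\<integral>\<^sup>+x. e2ennreal (- h x) \<partial>M)"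

definition dual_objective ::
    "(real \<Rightarrow> ennreal) \<Rightarrow> ('a set \<Rightarrow> real) \<Rightarrow> 'a measure \<Rightarrow> ('a \<Rightarrow> real) \<Rightarrow> ereal" where
  "dual_objective \<phi> Q P f =
     ereal (signed_integral P Q f) - ext_integral P (\<lambda>x. conjugate \<phi> (f x))"

definition dual_optimal ::
    "(real \<Rightarrow> ennreal) \<Rightarrow> ('a set \<Rightarrow> real) \<Rightarrow> 'a measure \<Rightarrow> ('a \<Rightarrow> real) set \<Rightarrow> ('a \<Rightarrow> real) \<Rightarrow> bool"
  where
  "dual_optimal \<phi> Q P F f \<longleftrightarrow>
     f \<in> F \<and> dual_objective \<phi> Q P f = (SUP h\<in>F. dual_objective \<phi> Q P h)"

end

theory Submission
  imports Defs
begin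

text \<open>Write \<open>g\<close> for the density \<open>dQ/dP\<close>. Then \<open>\<integral>f dQ = \<integral>f g dP\<close>, and both sides of the duality
  become integrals over \<open>P\<close> of expressions in \<open>f x\<close> and \<open>g x\<close>. Pointwise the Fenchel inequality
  \<open>f g - \<phi>\<^sup>*(f) \<le> \<phi>(g)\<close> holds, so integration shows that no dual objective exceeds the divergence.
  Equality holds at a point exactly when \<open>f x\<close> is a subgradient of \<open>\<phi>\<close> at \<open>g x\<close>
  (\<open>Fenchel_equality_iff\<close>). The derivative \<open>\<phi>'(g x)\<close> is one: inside the domain because a convex
  function lies above its tangents, and at a finite endpoint as a limit of tangents, using that
  \<open>\<phi>\<close> is closed (\<open>ext_deriv_subgradient\<close>). Hence \<open>\<phi>'(g)\<close> attains the bound, which is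
  therefore the supremum.

  Any optimal \<open>f\<close> has equality of the integrals, and as the integrands are ordered, equality holds
  almost everywhere (\<open>weak_duality\<close>); so \<open>f x\<close> is a subgradient at \<open>g x\<close> for almost every \<open>x\<close>.
  If \<open>\<phi>\<close> is essentially smooth, then \<open>g x\<close> cannot be an endpoint, because \<open>\<phi>'(g x)\<close> is
  a real number; and at an interior point the subgradient is unique (\<open>Fenchel_equality_unique\<close>).

  Two points need care. The density of a signed measure rests on the finiteness of its upper
  variation (\<open>signed_measure_bounded_above\<close>); once it is available, the variations are densities of
  the positive part, negative part and absolute value of \<open>g\<close>. And \<open>\<integral>\<phi>\<^sup>*(f) dP\<close> may be \<open>+\<infinity>\<close>; the
  integrable minorant \<open>f g - \<phi>(g)\<close> keeps its negative part finite (\<open>integral_le_ext_integral\<close>).\<close>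

section \<open>Signed measures and their densities\<close>

lemma signed_measure_Un:
  assumes Q: "Q \<in> signed_measures M" and A: "A \<in> sets M" and B: "B \<in> sets M"
    and disj: "A \<inter> B = {}"
  shows "Q (A \<union> B) = Q A + Q B"
proof -
  have "range (binaryset A B) \<subseteq> sets M"
    using A B by (auto simp: range_binaryset_eq)
  moreover have "disjoint_family (binaryset A B)"
    using disj by (auto simp: disjoint_family_on_def binaryset_def)
  ultimately have "(\<lambda>i. Q (binaryset A B i)) sums Q (A \<union> B)"
    using Q unfolding signed_measures_def by (auto simp: UN_binaryset_eq[symmetric] simp del: UN_binaryset_eq)
  moreover have "(\<lambda>i. Q (binaryset A B i)) sums (Q A + Q B)"
    using Q by (intro binaryset_sums) (auto simp: signed_measures_def)
  ultimately show ?thesis by (rule sums_unique2)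
qed

lemma signed_measure_Diff:
  assumes "Q \<in> signed_measures M" "A \<in> sets M" "B \<in> sets M" "B \<subseteq> A"
  shows "Q (A - B) = Q A - Q B"
proof -
  have "Q (B \<union> (A - B)) = Q B + Q (A - B)"
    using assms by (intro signed_measure_Un) auto
  moreover have "B \<union> (A - B) = A" using assms by auto
  ultimately show ?thesis by simp
qed

text \<open>A real-valued signed measure is automatically bounded. Call a set bad if \<open>Q\<close> is unbounded
  above on its subsets. A bad set has a subset \<open>B\<close> such that \<open>Q\<close> has absolute value at least \<open>1\<close>
  on both \<open>B\<close> and its complement in the bad set, and one of the two halves is bad again. Splitting off the other
  half repeatedly produces disjoint sets on which \<open>Q\<close> does not tend to zero, although the values
  of \<open>Q\<close> on them form a convergent series.\<close>

lemma signed_measure_bounded_above: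
  assumes Q: "Q \<in> signed_measures M"
  shows "\<exists>c. \<forall>B\<in>sets M. Q B \<le> c"
proof (rule ccontr)
  define bad where "bad A \<longleftrightarrow> A \<in> sets M \<and> (\<forall>c. \<exists>B\<in>sets M. B \<subseteq> A \<and> c < Q B)" for A
  assume "\<not> ?thesis"
  then have bad_space: "bad (space M)"
    unfolding bad_def by (meson linorder_not_le sets.sets_into_space sets.top)
  have split: "\<exists>A'. bad A' \<and> A' \<subseteq> A \<and> 1 \<le> \<bar>Q (A - A')\<bar>" if A: "bad A" for A
  proof -
    from A obtain B where B: "B \<in> sets M" "B \<subseteq> A" "\<bar>Q A\<bar> + 1 < Q B"
      unfolding bad_def by blast
    have A_sets: "A \<in> sets M" using A by (simp add: bad_def)
    have diff: "Q (A - B) = Q A - Q B"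
      using Q A_sets B by (intro signed_measure_Diff) auto
    show ?thesis
    proof (cases "bad B")
      case True
      with B diff show ?thesis by (intro exI[of _ B]) auto
    next
      case False
      then obtain c where c: "\<And>C. C \<in> sets M \<Longrightarrow> C \<subseteq> B \<Longrightarrow> Q C \<le> c"
        using B(1) unfolding bad_def by (meson linorder_not_le)
      have "bad (A - B)"
        unfolding bad_def
      proof (intro conjI allI)
        show "A - B \<in> sets M" using A_sets B by auto
        fix d
        from A obtain C where C: "C \<in> sets M" "C \<subseteq> A" "c + d < Q C"
          unfolding bad_def by blast
        have "Q (C - (C \<inter> B)) = Q C - Q (C \<inter> B)"
          using Q C B by (intro signed_measure_Diff) auto
        moreover have "Q (C \<inter> B) \<le> c" using c[of "C \<inter> B"] C B by auto
        ultimately have "d < Q (C - (C \<inter> B))" using C by simp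
        then show "\<exists>B'\<in>sets M. B' \<subseteq> A - B \<and> d < Q B'"
          using C B by (intro bexI[of _ "C - (C \<inter> B)"]) auto
      qed
      moreover have "A - (A - B) = B" using B by auto
      ultimately show ?thesis using B by (intro exI[of _ "A - B"]) auto
    qed
  qed
  obtain A where A: "\<And>n. bad (A n)" "\<And>n. A (Suc n) \<subseteq> A n" "\<And>n::nat. 1 \<le> \<bar>Q (A n - A (Suc n))\<bar>"
    using dependent_nat_choice[of "\<lambda>_. bad" "\<lambda>_ A A'. A' \<subseteq> A \<and> 1 \<le> \<bar>Q (A - A')\<bar>"] bad_space split
    by metis
  define D where "D n = A n - A (Suc n)" for n
  have mono: "A n \<subseteq> A m" if "m \<le> n" for m n
    using lift_Suc_antimono_le[of A, OF A(2) that] .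
  have "disjoint_family D"
    unfolding disjoint_family_on_def
  proof (intro ballI impI)
    fix m n :: nat
    assume "m \<noteq> n"
    then have "Suc m \<le> n \<or> Suc n \<le> m" by linarith
    then show "D m \<inter> D n = {}"
      using mono[of "Suc m" n] mono[of "Suc n" m] by (auto simp: D_def)
  qed
  moreover have "range D \<subseteq> sets M" using A(1) by (auto simp: D_def bad_def)
  ultimately have "(\<lambda>n. Q (D n)) sums Q (\<Union>n. D n)"
    using Q unfolding signed_measures_def by blast
  then have "(\<lambda>n. Q (D n)) \<longlonglongrightarrow> 0"
    by (intro summable_LIMSEQ_zero sums_summable)
  then have "eventually (\<lambda>n. \<bar>Q (D n)\<bar> < 1) sequentially"
    using tendstoD[of "\<lambda>n. Q (D n)" 0 sequentially 1] by (simp add: dist_real_def)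
  then show False
    using A(3) by (auto simp: D_def eventually_sequentially not_le[symmetric])
qed

lemma ennreal_sum_le: "ennreal (\<Sum>i\<in>I. f i) \<le> (\<Sum>i\<in>I. ennreal (f i))" for f :: "'b \<Rightarrow> real"
proof (induction I rule: infinite_finite_induct)
  case (insert i I)
  have "ennreal (a + b) \<le> ennreal a + ennreal b" for a b :: real
    by (cases "0 \<le> a"; cases "0 \<le> b")
      (auto simp: ennreal_neg ennreal_plus[symmetric] simp del: ennreal_plus intro!: ennreal_leI)
  from this[of "f i" "sum f I"] insert show ?case
    by (auto intro: order_trans add_left_mono)
qed auto

lemma upper_variation_superadditive:
  assumes Q: "Q \<in> signed_measures M" and A: "A \<in> sets M" and B: "B \<in> sets M" and disj: "A \<inter> B = {}"
  shows "(SUP C\<in>{C\<in>sets M. C \<subseteq> A}. ennreal (Q C)) + (SUP D\<in>{D\<in>sets M. D \<subseteq> B}. ennreal (Q D))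
    \<le> (SUP E\<in>{E\<in>sets M. E \<subseteq> A \<union> B}. ennreal (Q E))"
proof -
  have pair: "ennreal (Q C) + ennreal (Q D) \<le> (SUP E\<in>{E\<in>sets M. E \<subseteq> A \<union> B}. ennreal (Q E))"
    if C: "C \<in> sets M" "C \<subseteq> A" and D: "D \<in> sets M" "D \<subseteq> B" for C D
  proof -
    consider "Q C < 0" | "Q D < 0" | "0 \<le> Q C" "0 \<le> Q D" by linarith
    then show ?thesis
    proof cases
      case 1
      then show ?thesis using D by (auto simp: ennreal_neg intro!: SUP_upper2[of D])
    next
      case 2
      then show ?thesis using C by (auto simp: ennreal_neg intro!: SUP_upper2[of C])
    next
      case 3
      have "Q (C \<union> D) = Q C + Q D"
        using Q C D disj by (intro signed_measure_Un) auto
      with 3 have "ennreal (Q C) + ennreal (Q D) = ennreal (Q (C \<union> D))"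
        by simp
      then show ?thesis using C D by (auto intro!: SUP_upper2[of "C \<union> D"])
    qed
  qed
  have "ennreal (Q C) + (SUP D\<in>{D\<in>sets M. D \<subseteq> B}. ennreal (Q D))
      \<le> (SUP E\<in>{E\<in>sets M. E \<subseteq> A \<union> B}. ennreal (Q E))" if "C \<in> sets M" "C \<subseteq> A" for C
  proof -
    have ne: "{D\<in>sets M. D \<subseteq> B} \<noteq> {}" by auto
    show ?thesis
      unfolding ennreal_SUP_add_right[OF ne]
      by (rule SUP_least) (use that pair in auto)
  qed
  moreover have "{C\<in>sets M. C \<subseteq> A} \<noteq> {}" by auto
  ultimately show ?thesis
    by (subst ennreal_SUP_add_left[symmetric]) (auto intro: SUP_least)
qed

text \<open>One inequality comes from superadditivity over finite unions. For the other, a set \<open>B\<close> inside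
  the union is cut into the pieces \<open>B \<inter> A i\<close>; the partial sums of their \<open>Q\<close>-values converge to
  \<open>Q B\<close>, and \<open>ennreal\<close> of each partial sum is at most the sum of the suprema.\<close>

lemma countably_additive_upper_variation:
  assumes Q: "Q \<in> signed_measures M"
  shows "countably_additive (sets M) (\<lambda>A. SUP B\<in>{B\<in>sets M. B \<subseteq> A}. ennreal (Q B))"
    (is "countably_additive _ ?u")
proof (rule countably_additiveI)
  fix A :: "nat \<Rightarrow> 'a set"
  assume A: "range A \<subseteq> sets M" "disjoint_family A"
  show "(\<Sum>i. ?u (A i)) = ?u (\<Union>i. A i)"
  proof (rule antisym)
    have "(\<Sum>i<n. ?u (A i)) \<le> ?u (\<Union>i<n. A i)" for n
    proof (induction n)
      case (Suc n)
      have "(\<Union>i<n. A i) \<inter> A n = {}"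
        using A(2) by (auto simp: disjoint_family_on_def) (metis disjoint_iff less_irrefl)
      then have "?u (\<Union>i<n. A i) + ?u (A n) \<le> ?u ((\<Union>i<n. A i) \<union> A n)"
        using A by (intro upper_variation_superadditive[OF Q]) auto
      moreover have "(\<Union>i<n. A i) \<union> A n = (\<Union>i<Suc n. A i)"
        by (auto simp: less_Suc_eq)
      ultimately have "?u (\<Union>i<n. A i) + ?u (A n) \<le> ?u (\<Union>i<Suc n. A i)" by metis
      then show ?case
        unfolding sum.lessThan_Suc using add_right_mono[OF Suc.IH] order_trans by blast
    qed simp
    moreover have "?u (\<Union>i<n. A i) \<le> ?u (\<Union>i. A i)" for n
      by (intro SUP_subset_mono) auto
    ultimately show "(\<Sum>i. ?u (A i)) \<le> ?u (\<Union>i. A i)"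
      by (intro suminf_le_const) (auto intro: order_trans)
  next
    show "?u (\<Union>i. A i) \<le> (\<Sum>i. ?u (A i))"
    proof (rule SUP_least, clarify)
      fix B assume B: "B \<in> sets M" "B \<subseteq> (\<Union>i. A i)"
      have "range (\<lambda>i. B \<inter> A i) \<subseteq> sets M" using A B by auto
      moreover have "disjoint_family (\<lambda>i. B \<inter> A i)"
        using A(2) by (rule disjoint_family_on_bisimulation) auto
      ultimately have "(\<lambda>i. Q (B \<inter> A i)) sums Q (\<Union>i. B \<inter> A i)"
        using Q unfolding signed_measures_def by blast
      moreover have "(\<Union>i. B \<inter> A i) = B" using B by auto
      ultimately have "(\<lambda>n. \<Sum>i<n. Q (B \<inter> A i)) \<longlonglongrightarrow> Q B"
        by (simp add: sums_def)
      then have "(\<lambda>n. ennreal (\<Sum>i<n. Q (B \<inter> A i))) \<longlonglongrightarrow> ennreal (Q B)"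
        by (rule tendsto_ennrealI)
      moreover have "ennreal (\<Sum>i<n. Q (B \<inter> A i)) \<le> (\<Sum>i. ?u (A i))" for n
      proof -
        have "ennreal (\<Sum>i<n. Q (B \<inter> A i)) \<le> (\<Sum>i<n. ennreal (Q (B \<inter> A i)))"
          by (rule ennreal_sum_le)
        also have "\<dots> \<le> (\<Sum>i<n. ?u (A i))"
          using A B by (intro sum_mono SUP_upper) auto
        also have "\<dots> \<le> (\<Sum>i. ?u (A i))"
          by (intro sum_le_suminf) auto
        finally show ?thesis .
      qed
      ultimately show "ennreal (Q B) \<le> (\<Sum>i. ?u (A i))"
        by (intro LIMSEQ_le_const2) auto
    qed
  qed
qed

lemma space_upper_variation [simp]: "space (upper_variation M Q) = space M"
  and sets_upper_variation [simp]: "sets (upper_variation M Q) = sets M"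
  by (simp_all add: upper_variation_def)

lemma emeasure_upper_variation:
  assumes Q: "Q \<in> signed_measures M" and A: "A \<in> sets M"
  shows "emeasure (upper_variation M Q) A = (SUP B\<in>{B\<in>sets M. B \<subseteq> A}. ennreal (Q B))"
  unfolding upper_variation_def
proof (rule emeasure_measure_of_sigma[OF _ _ countably_additive_upper_variation[OF Q] A])
  have "{B \<in> sets M. B \<subseteq> {}} = {{}}" by auto
  then show "positive (sets M) (\<lambda>A. SUP B\<in>{B\<in>sets M. B \<subseteq> A}. ennreal (Q B))"
    using Q by (simp add: positive_def signed_measures_def)
qed (rule sets.sigma_algebra_axioms)

lemma finite_measure_upper_variation:
  assumes Q: "Q \<in> signed_measures M"
  shows "finite_measure (upper_variation M Q)"
proof
  obtain c where c: "\<And>B. B \<in> sets M \<Longrightarrow> Q B \<le> c"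
    using signed_measure_bounded_above[OF Q] by blast
  have "emeasure (upper_variation M Q) (space M) \<le> ennreal c"
    using c by (auto simp: emeasure_upper_variation[OF Q] intro!: SUP_least ennreal_leI)
  then show "emeasure (upper_variation M Q) (space (upper_variation M Q)) \<noteq> \<infinity>"
    by (auto simp: top_unique)
qed

text \<open>Subtracting \<open>Q\<close> from its upper variation leaves a second finite measure, so the unsigned
  Radon-Nikodym theorem applies to both summands of this decomposition.\<close>

lemma signed_measure_decomposition:
  assumes Q: "Q \<in> signed_measures M"
  obtains N where "finite_measure N" "sets N = sets M"
    "\<And>A. A \<in> sets M \<Longrightarrow> Q A = measure (upper_variation M Q) A - measure N A"
proof -
  interpret U: finite_measure "upper_variation M Q"
    by (rule finite_measure_upper_variation[OF Q])
  define m where "m A = measure (upper_variation M Q) A - Q A" for A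
  have m_nonneg: "0 \<le> m A" if A: "A \<in> sets M" for A
  proof -
    have "ennreal (Q A) \<le> emeasure (upper_variation M Q) A"
      using A by (auto simp: emeasure_upper_variation[OF Q] intro!: SUP_upper)
    then show ?thesis
      by (simp add: m_def U.emeasure_eq_measure ennreal_le_iff)
  qed
  define N where "N = measure_of (space M) (sets M) (\<lambda>A. ennreal (m A))"
  have N: "emeasure N A = ennreal (m A)" if A: "A \<in> sets M" for A
    unfolding N_def
  proof (rule emeasure_measure_of_sigma[OF _ _ _ A])
    show "sigma_algebra (space M) (sets M)" by (rule sets.sigma_algebra_axioms)
    show "positive (sets M) (\<lambda>A. ennreal (m A))"
      using Q by (simp add: positive_def m_def signed_measures_def)
    show "countably_additive (sets M) (\<lambda>A. ennreal (m A))"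
    proof (rule countably_additiveI)
      fix A :: "nat \<Rightarrow> 'a set"
      assume A: "range A \<subseteq> sets M" "disjoint_family A"
      have "(\<lambda>i. m (A i)) sums m (\<Union>i. A i)"
        unfolding m_def
        using Q A by (intro sums_diff U.finite_measure_UNION) (auto simp: signed_measures_def)
      then show "(\<Sum>i. ennreal (m (A i))) = ennreal (m (\<Union>i. A i))"
        using A m_nonneg by (intro suminf_ennreal_eq) auto
    qed
  qed
  have sets_N: "sets N = sets M" by (simp add: N_def)
  show thesis
  proof
    show "finite_measure N"
      using N[of "space M"] sets_eq_imp_space_eq[OF sets_N] by (intro finite_measureI) auto
    show "sets N = sets M" by (rule sets_N)
    show "Q A = measure (upper_variation M Q) A - measure N A" if "A \<in> sets M" for A
      using N[OF that] m_nonneg[OF that] by (simp add: measure_def m_def)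
  qed
qed

theorem signed_Radon_Nikodym:
  assumes P: "sigma_finite_measure P" and Q: "Q \<in> ac_signed_measures P"
  shows "\<exists>g. integrable P g \<and> (\<forall>A\<in>sets P. Q A = (LINT x:A|P. g x))"
proof -
  interpret sigma_finite_measure P by (rule P)
  let ?U = "upper_variation P Q"
  have Qs: "Q \<in> signed_measures P" and ac: "\<And>A. A \<in> null_sets P \<Longrightarrow> Q A = 0"
    using Q by (auto simp: ac_signed_measures_def)
  interpret U: finite_measure ?U
    by (rule finite_measure_upper_variation[OF Qs])
  obtain N where N: "finite_measure N" "sets N = sets P"
    and QN: "\<And>A. A \<in> sets P \<Longrightarrow> Q A = measure ?U A - measure N A"
    using signed_measure_decomposition[OF Qs] by metis
  interpret N: finite_measure N by (rule N(1))
  have U_null: "emeasure ?U A = 0" if A: "A \<in> null_sets P" for A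
  proof -
    have "emeasure ?U A = (SUP B\<in>{B\<in>sets P. B \<subseteq> A}. ennreal (Q B))"
      using A by (intro emeasure_upper_variation[OF Qs]) auto
    also have "\<dots> \<le> 0"
      using A by (intro SUP_least) (auto simp: ac null_sets_subset)
    finally show ?thesis by simp
  qed
  have acU: "absolutely_continuous P ?U"
    using U_null by (auto simp: absolutely_continuous_def null_sets_def)
  have "emeasure N A = 0" if A: "A \<in> null_sets P" for A
    using QN[of A] U_null[OF A] ac[OF A] A
    by (simp add: N.emeasure_eq_measure U.emeasure_eq_measure null_sets_def)
  then have acN: "absolutely_continuous P N"
    using N(2) by (auto simp: absolutely_continuous_def null_sets_def)
  have density: "\<exists>D. integrable P D \<and> (\<forall>A\<in>sets P. measure K A = (LINT x:A|P. D x))"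
    if K: "finite_measure K" "absolutely_continuous P K" "sets K = sets P" for K
  proof -
    interpret K: finite_measure K by (rule K(1))
    obtain D where D [measurable]: "D \<in> borel_measurable P"
      and RN: "AE x in P. RN_deriv P K x = ennreal (D x)" and nn: "\<And>x. 0 \<le> D x"
      using real_RN_deriv[OF K] by metis
    have "density P (\<lambda>x. ennreal (D x)) = density P (RN_deriv P K)"
      using RN by (intro density_cong) auto
    also have "\<dots> = K" using K by (intro density_RN_deriv) auto
    finally have DK: "density P (\<lambda>x. ennreal (D x)) = K" .
    have e: "(\<integral>\<^sup>+x. ennreal (indicator A x * D x) \<partial>P) = emeasure K A" if [measurable]: "A \<in> sets P" for A
      unfolding DK[symmetric]
      by (subst emeasure_density) (auto intro!: nn_integral_cong split: split_indicator)
    have "integrable P D"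
    proof (rule integrableI_nonneg)
      have "(\<integral>\<^sup>+x. ennreal (D x) \<partial>P) = emeasure K (space P)"
        unfolding e[OF sets.top, symmetric] by (intro nn_integral_cong) auto
      then show "(\<integral>\<^sup>+x. ennreal (D x) \<partial>P) < \<infinity>"
        by (simp add: K.emeasure_eq_measure)
    qed (use nn in auto)
    moreover have "measure K A = (LINT x:A|P. D x)" if A [measurable]: "A \<in> sets P" for A
      unfolding set_lebesgue_integral_def real_scaleR_def measure_def e[OF A, symmetric]
      using nn by (subst integral_eq_nn_integral) auto
    ultimately show ?thesis by blast
  qed
  obtain D1 where D1: "integrable P D1" "\<And>A. A \<in> sets P \<Longrightarrow> measure ?U A = (LINT x:A|P. D1 x)"
    using density[OF U.finite_measure_axioms acU] by auto
  obtain D2 where D2: "integrable P D2" "\<And>A. A \<in> sets P \<Longrightarrow> measure N A = (LINT x:A|P. D2 x)"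
    using density[OF N(1) acN N(2)] by auto
  have "Q A = (LINT x:A|P. D1 x - D2 x)" if A: "A \<in> sets P" for A
    using QN[OF A] D1 D2 A
    by (subst set_integral_diff) (auto simp: set_integrable_def simp del: real_scaleR_def intro: integrable_mult_indicator)
  with D1(1) D2(1) show ?thesis
    by (intro exI[of _ "\<lambda>x. D1 x - D2 x"]) auto
qed

lemma signed_RN_deriv:
  assumes "sigma_finite_measure P" "Q \<in> ac_signed_measures P"
  shows "integrable P (signed_RN_deriv P Q)"
    and "\<And>A. A \<in> sets P \<Longrightarrow> Q A = (LINT x:A|P. signed_RN_deriv P Q x)"
  using someI_ex[OF signed_Radon_Nikodym[OF assms]] by (auto simp: signed_RN_deriv_def)

text \<open>The supremum defining the upper variation of \<open>A\<close> is attained at the part of \<open>A\<close> where the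
  density is nonnegative. Negative densities need no truncation because \<open>ennreal\<close> sends them to \<open>0\<close>.\<close>

lemma upper_variation_eq_density:
  assumes g: "integrable P g" and Q: "\<And>A. A \<in> sets P \<Longrightarrow> Q A = (LINT x:A|P. g x)"
  shows "upper_variation P Q = density P (\<lambda>x. ennreal (g x))"
proof -
  have [measurable]: "g \<in> borel_measurable P" using g by auto
  have int: "integrable P (\<lambda>x. indicator A x * h x)"
    if "A \<in> sets P" "integrable P h" for A and h :: "'a \<Rightarrow> real"
    using integrable_mult_indicator[OF that] by simp
  have "(SUP B\<in>{B\<in>sets P. B \<subseteq> A}. ennreal (Q B)) = emeasure (density P (\<lambda>x. ennreal (g x))) A"
    if A [measurable]: "A \<in> sets P" for A
  proof -
    have "(\<integral>\<^sup>+x. ennreal (g x) * indicator A x \<partial>P) = (\<integral>\<^sup>+x. ennreal (indicator A x * max 0 (g x)) \<partial>P)"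
      by (intro nn_integral_cong) (auto split: split_indicator simp: max_def ennreal_neg)
    also have "\<dots> = ennreal (\<integral>x. indicator A x * max 0 (g x) \<partial>P)"
      using g A by (intro nn_integral_eq_integral int integrable_max) auto
    finally have em: "emeasure (density P (\<lambda>x. ennreal (g x))) A = ennreal (\<integral>x. indicator A x * max 0 (g x) \<partial>P)"
      by (simp add: emeasure_density)
    show ?thesis
      unfolding em
    proof (rule antisym)
      show "(SUP B\<in>{B\<in>sets P. B \<subseteq> A}. ennreal (Q B)) \<le> ennreal (\<integral>x. indicator A x * max 0 (g x) \<partial>P)"
      proof (rule SUP_least, clarify, rule ennreal_leI)
        fix B assume B: "B \<in> sets P" "B \<subseteq> A"
        show "Q B \<le> (\<integral>x. indicator A x * max 0 (g x) \<partial>P)"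
          unfolding Q[OF B(1)] set_lebesgue_integral_def real_scaleR_def
          using B A g by (intro integral_mono int integrable_max) (auto split: split_indicator)
      qed
      define B where "B = {x\<in>space P. 0 \<le> g x} \<inter> A"
      have B: "B \<in> sets P" "B \<subseteq> A" by (auto simp: B_def)
      have "(\<integral>x. indicator A x * max 0 (g x) \<partial>P) = Q B"
        unfolding Q[OF B(1)] set_lebesgue_integral_def real_scaleR_def
        by (intro Bochner_Integration.integral_cong) (auto simp: B_def split: split_indicator)
      then show "ennreal (\<integral>x. indicator A x * max 0 (g x) \<partial>P) \<le> (SUP B\<in>{B\<in>sets P. B \<subseteq> A}. ennreal (Q B))"
        using B by (auto intro!: SUP_upper2[of B])
    qed
  qed
  then have "upper_variation P Q = measure_of (space P) (sets P) (emeasure (density P (\<lambda>x. ennreal (g x))))"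
    unfolding upper_variation_def using sets.space_closed[of P]
    by (intro measure_of_eq) (auto simp: sets.sigma_sets_eq)
  also have "\<dots> = density P (\<lambda>x. ennreal (g x))"
    using measure_of_of_measure[of "density P (\<lambda>x. ennreal (g x))"] by simp
  finally show ?thesis .
qed

lemma lower_variation_eq_density:
  assumes g: "integrable P g" and Q: "\<And>A. A \<in> sets P \<Longrightarrow> Q A = (LINT x:A|P. g x)"
  shows "lower_variation P Q = density P (\<lambda>x. ennreal (- g x))"
  unfolding lower_variation_def
  using assms by (intro upper_variation_eq_density) (auto simp: set_lebesgue_integral_def)

lemma total_variation_eq_density:
  assumes g: "integrable P g" and Q: "\<And>A. A \<in> sets P \<Longrightarrow> Q A = (LINT x:A|P. g x)"
  shows "total_variation P Q = density P (\<lambda>x. ennreal \<bar>g x\<bar>)"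
proof -
  have [measurable]: "g \<in> borel_measurable P" using g by auto
  have densities: "upper_variation P Q = density P (\<lambda>x. ennreal (g x))"
    "lower_variation P Q = density P (\<lambda>x. ennreal (- g x))"
    by (intro upper_variation_eq_density lower_variation_eq_density g Q; assumption)+
  have "emeasure (upper_variation P Q) A + emeasure (lower_variation P Q) A
      = emeasure (density P (\<lambda>x. ennreal \<bar>g x\<bar>)) A" if [measurable]: "A \<in> sets P" for A
    unfolding densities
    by (simp add: emeasure_density nn_integral_add[symmetric])
      (auto intro!: nn_integral_cong split: split_indicator simp: abs_if ennreal_neg)
  then have "total_variation P Q = measure_of (space P) (sets P) (emeasure (density P (\<lambda>x. ennreal \<bar>g x\<bar>)))"
    unfolding total_variation_def using sets.space_closed[of P]
    by (intro measure_of_eq) (auto simp: sets.sigma_sets_eq)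
  also have "\<dots> = density P (\<lambda>x. ennreal \<bar>g x\<bar>)"
    using measure_of_of_measure[of "density P (\<lambda>x. ennreal \<bar>g x\<bar>)"] by simp
  finally show ?thesis .
qed

lemma signed_integral_eq_lebesgue_integral:
  assumes g: "integrable P g" and Q: "\<And>A. A \<in> sets P \<Longrightarrow> Q A = (LINT x:A|P. g x)"
    and f [measurable]: "f \<in> borel_measurable P"
    and fin: "(\<integral>\<^sup>+x. ennreal \<bar>f x\<bar> \<partial>total_variation P Q) < \<infinity>"
  shows "integrable P (\<lambda>x. f x * g x)" and "signed_integral P Q f = (\<integral>x. f x * g x \<partial>P)"
proof -
  have [measurable]: "g \<in> borel_measurable P" using g by auto
  have densities: "upper_variation P Q = density P (\<lambda>x. ennreal (g x))"
    "lower_variation P Q = density P (\<lambda>x. ennreal (- g x))"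
    "total_variation P Q = density P (\<lambda>x. ennreal \<bar>g x\<bar>)"
    by (intro upper_variation_eq_density lower_variation_eq_density total_variation_eq_density g Q; assumption)+
  have "(\<integral>\<^sup>+x. ennreal \<bar>f x\<bar> \<partial>total_variation P Q) = (\<integral>\<^sup>+x. ennreal (norm (f x * g x)) \<partial>P)"
    unfolding densities
    by (auto simp: nn_integral_density abs_mult ennreal_mult mult.commute intro!: nn_integral_cong)
  with fin show fg: "integrable P (\<lambda>x. f x * g x)"
    by (intro integrableI_bounded) auto
  have part: "(\<integral>x. f x \<partial>density P (\<lambda>x. ennreal (h x))) = (\<integral>x. f x * max 0 (h x) \<partial>P)"
    if [measurable]: "h \<in> borel_measurable P" for h
  proof -
    have eq: "density P (\<lambda>x. ennreal (h x)) = density P (\<lambda>x. ennreal (max 0 (h x)))"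
      by (intro density_cong) (auto simp: max_def ennreal_neg)
    show ?thesis
      unfolding eq by (subst integral_density) (auto simp: mult.commute)
  qed
  have "integrable P (\<lambda>x. f x * max 0 (g x))" "integrable P (\<lambda>x. f x * max 0 (- g x))"
    by (auto intro!: Bochner_Integration.integrable_bound[OF fg] simp: abs_mult mult_left_mono)
  then have "signed_integral P Q f = (\<integral>x. f x * max 0 (g x) - f x * max 0 (- g x) \<partial>P)"
    by (simp add: signed_integral_def part densities)
  also have "\<dots> = (\<integral>x. f x * g x \<partial>P)"
    by (intro Bochner_Integration.integral_cong) (auto simp: max_def)
  finally show "signed_integral P Q f = (\<integral>x. f x * g x \<partial>P)" .
qed

section \<open>Convex functions on the line and their conjugates\<close>

lemma edomD: "x \<in> edom \<phi> \<Longrightarrow> \<phi> x = ennreal (enn2real (\<phi> x))"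
  by (simp add: edom_def)

lemma edom_bounds:
  assumes "x \<in> edom \<phi>"
  shows "dom_lo \<phi> \<le> ereal x" "ereal x \<le> dom_hi \<phi>"
  using assms by (auto simp: dom_lo_def dom_hi_def intro: INF_lower SUP_upper)

lemma between_endpoints_in_edom:
  assumes "is_interval (edom \<phi>)" "dom_lo \<phi> < ereal x" "ereal x < dom_hi \<phi>"
  shows "x \<in> edom \<phi>"
proof -
  obtain a b where "a \<in> edom \<phi>" "b \<in> edom \<phi>" "a < x" "x < b"
    using assms(2,3) by (auto simp: dom_lo_def dom_hi_def INF_less_iff less_SUP_iff)
  with assms(1) show ?thesis unfolding is_interval_1 by (metis less_imp_le)
qed

lemma open_between_endpoints: "open {x. dom_lo \<phi> < ereal x \<and> ereal x < dom_hi \<phi>}"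
  by (intro open_Collect_conj open_Collect_less continuous_intros)

lemma between_endpoints_in_interior:
  assumes "is_interval (edom \<phi>)" "dom_lo \<phi> < ereal x" "ereal x < dom_hi \<phi>"
  shows "x \<in> interior (edom \<phi>)"
  using assms between_endpoints_in_edom[OF assms(1)]
  by (intro interiorI[OF open_between_endpoints[of \<phi>]]) auto

lemma econvex_convex_on:
  assumes conv: "econvex \<phi>" and int: "is_interval (edom \<phi>)"
  shows "convex_on (edom \<phi>) (\<lambda>x. enn2real (\<phi> x))"
proof
  show "convex (edom \<phi>)" using int by (simp add: is_interval_convex)
  fix t x y :: real
  assume t: "0 < t" "t < 1" and x: "x \<in> edom \<phi>" and y: "y \<in> edom \<phi>"
  let ?r = "\<lambda>x. enn2real (\<phi> x)"
  have "\<phi> ((1 - t) * x + t * y) \<le> ennreal (1 - t) * \<phi> x + ennreal t * \<phi> y"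
    using conv[unfolded econvex_def, rule_format, of "1 - t" x y] t by simp
  also have "\<dots> = ennreal ((1 - t) * ?r x + t * ?r y)"
  proof -
    obtain a b where ab: "\<phi> x = ennreal a" "\<phi> y = ennreal b" "0 \<le> a" "0 \<le> b"
      using edomD[OF x] edomD[OF y] by (metis enn2real_nonneg)
    show ?thesis
      using t by (simp add: ab ennreal_mult[symmetric] ennreal_plus[symmetric] del: ennreal_plus)
  qed
  finally show "?r ((1 - t) *\<^sub>R x + t *\<^sub>R y) \<le> (1 - t) * ?r x + t * ?r y"
    using t by (intro enn2real_leI) auto
qed

text \<open>Convexity makes the sublevel sets intervals.\<close>

lemma econvex_borel_measurable:
  assumes conv: "econvex \<phi>"
  shows "\<phi> \<in> borel_measurable borel"
proof (rule borel_measurableI_le)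
  fix c :: ennreal
  have "convex {x. \<phi> x \<le> c}"
  proof (rule convexI)
    fix x y u v :: real
    assume xy: "x \<in> {x. \<phi> x \<le> c}" "y \<in> {x. \<phi> x \<le> c}" and uv: "0 \<le> u" "0 \<le> v" "u + v = 1"
    then have v: "v = 1 - u" by simp
    have "\<phi> (u * x + (1 - u) * y) \<le> ennreal u * \<phi> x + ennreal (1 - u) * \<phi> y"
      using conv[unfolded econvex_def, rule_format, of u x y] uv by simp
    also have "\<dots> \<le> ennreal u * c + ennreal (1 - u) * c"
      using xy by (intro add_mono mult_left_mono) auto
    also have "\<dots> = c"
      using uv by (simp add: distrib_right[symmetric] ennreal_plus[symmetric] del: ennreal_plus)
    finally show "u *\<^sub>R x + v *\<^sub>R y \<in> {x. \<phi> x \<le> c}" by (simp add: v)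
  qed
  then show "{x \<in> space borel. \<phi> x \<le> c} \<in> sets borel"
    using real_interval_borel_measurable[of "{x. \<phi> x \<le> c}"] by (simp add: is_interval_convex_1)
qed

text \<open>The conjugate is a supremum of affine functions, hence lower semicontinuous: its strict
  superlevel sets are open.\<close>

lemma conjugate_borel_measurable: "conjugate \<phi> \<in> borel_measurable borel"
proof (rule borel_measurableI_greater)
  fix c :: ereal
  have "continuous_on UNIV (\<lambda>t. ereal (t * x) - enn2ereal (\<phi> x))" for x
  proof (cases "\<phi> x")
    case (real r)
    then show ?thesis by (auto intro!: continuous_intros)
  next
    case top
    then show ?thesis by simp
  qed
  then have "open {t. c < ereal (t * x) - enn2ereal (\<phi> x)}" for x
    by (intro open_Collect_less) auto
  then have "open (\<Union>x. {t. c < ereal (t * x) - enn2ereal (\<phi> x)})" by blast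
  moreover have "{t \<in> space borel. c < conjugate \<phi> t} = (\<Union>x. {t. c < ereal (t * x) - enn2ereal (\<phi> x)})"
    by (auto simp: conjugate_def less_SUP_iff)
  ultimately show "{t \<in> space borel. c < conjugate \<phi> t} \<in> sets borel" by simp
qed

lemma Fenchel_inequality:
  assumes "x \<in> edom \<phi>"
  shows "ereal (t * x - enn2real (\<phi> x)) \<le> conjugate \<phi> t"
proof -
  have "ereal (t * x - enn2real (\<phi> x)) = ereal (t * x) - enn2ereal (\<phi> x)"
    by (subst (2) edomD[OF assms]) simp
  then show ?thesis by (auto simp: conjugate_def intro!: SUP_upper2)
qed

text \<open>The right-hand side says that \<open>t\<close> is a subgradient of \<open>\<phi>\<close> at \<open>x\<close>; rearranged, it says that
  the supremum defining the conjugate at \<open>t\<close> is attained at \<open>x\<close>.\<close>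

lemma Fenchel_equality_iff:
  assumes x: "x \<in> edom \<phi>"
  shows "conjugate \<phi> t = ereal (t * x - enn2real (\<phi> x)) \<longleftrightarrow>
    (\<forall>z\<in>edom \<phi>. t * (z - x) \<le> enn2real (\<phi> z) - enn2real (\<phi> x))" (is "?l \<longleftrightarrow> ?r")
proof
  assume l: ?l
  show ?r
  proof
    fix z assume "z \<in> edom \<phi>"
    from Fenchel_inequality[OF this, of t]
    show "t * (z - x) \<le> enn2real (\<phi> z) - enn2real (\<phi> x)"
      unfolding l by (simp add: algebra_simps)
  qed
next
  assume r: ?r
  have "ereal (t * z) - enn2ereal (\<phi> z) \<le> ereal (t * x - enn2real (\<phi> x))" for z
  proof (cases "z \<in> edom \<phi>")
    case True
    have "ereal (t * z) - enn2ereal (\<phi> z) = ereal (t * z - enn2real (\<phi> z))"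
      by (subst edomD[OF True]) simp
    then show ?thesis using r True by (auto simp: algebra_simps)
  next
    case False
    then show ?thesis by (simp add: edom_def not_less top_unique)
  qed
  then have "conjugate \<phi> t \<le> ereal (t * x - enn2real (\<phi> x))"
    unfolding conjugate_def by (intro SUP_least)
  then show ?l using Fenchel_inequality[OF x, of t] by (rule antisym)
qed

locale differentiable_divergence =
  fixes \<phi> :: "real \<Rightarrow> ennreal"
  assumes divergence_fun: "divergence_fun \<phi>" and differentiable: "differentiable_fun \<phi>"
begin

abbreviation r :: "real \<Rightarrow> real" where "r x \<equiv> enn2real (\<phi> x)"

abbreviation "dom_int \<equiv> {x. dom_lo \<phi> < ereal x \<and> ereal x < dom_hi \<phi>}"

lemma interval: "is_interval (edom \<phi>)"
  and convex: "convex_on (edom \<phi>) r"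
  and endpoints: "dom_lo \<phi> < dom_hi \<phi>"
  using divergence_fun econvex_convex_on[of \<phi>] by (auto simp: divergence_fun_def)

lemma measurable_phi [measurable]: "\<phi> \<in> borel_measurable borel"
  using divergence_fun by (intro econvex_borel_measurable) (simp add: divergence_fun_def)

lemma inside_edom: "x \<in> dom_int \<Longrightarrow> x \<in> edom \<phi>"
  using between_endpoints_in_edom[OF interval] by simp

lemma has_derivative_inside: "x \<in> dom_int \<Longrightarrow> (r has_real_derivative deriv r x) (at x)"
  using differentiable by (auto simp: differentiable_fun_def DERIV_deriv_iff_real_differentiable)

lemma tangent_inside:
  assumes x: "x \<in> dom_int" and z: "z \<in> edom \<phi>"
  shows "deriv r x * (z - x) \<le> r z - r x"
  using x z between_endpoints_in_interior[OF interval] has_derivative_inside[OF x]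
  by (intro convex_on_imp_above_tangent[OF convex])
    (auto simp: is_interval_connected interval has_field_derivative_at_within)

lemma deriv_mono:
  assumes "x \<in> dom_int" "y \<in> dom_int" "x \<le> y"
  shows "deriv r x \<le> deriv r y"
proof (cases "x = y")
  case False
  have "deriv r x * (y - x) \<le> r y - r x" "deriv r y * (x - y) \<le> r x - r y"
    using assms by (auto intro!: tangent_inside inside_edom)
  then have "(deriv r x - deriv r y) * (y - x) \<le> 0" by (simp add: algebra_simps)
  with False assms(3) show ?thesis by (simp add: mult_le_0_iff)
qed simp

text \<open>At a finite endpoint \<open>ext_deriv\<close> is defined by \<open>Lim\<close>, which says something only if the limit
  exists. It does, because the monotone derivative tends to its infimum at the lower endpoint and to
  its supremum at the upper one.\<close>

lemma deriv_tendsto_lo: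
  assumes a: "dom_lo \<phi> = ereal a"
  shows "((\<lambda>y. ereal (deriv r y)) \<longlongrightarrow> ext_deriv \<phi> a) (at_right a)"
    and "eventually (\<lambda>y. y \<in> dom_int) (at_right a)"
proof -
  obtain b where b: "a < b" "ereal b < dom_hi \<phi>"
    using ereal_dense2[OF endpoints] a by auto
  have ins: "y \<in> dom_int" if "a < y" "y < b" for y
    using that a b by (auto intro: less_trans[of _ "ereal b"])
  show ev: "eventually (\<lambda>y. y \<in> dom_int) (at_right a)"
    using b(1) ins by (auto simp: eventually_at_right_field)
  define L where "L = (INF y\<in>dom_int. ereal (deriv r y))"
  have "((\<lambda>y. ereal (deriv r y)) \<longlongrightarrow> L) (at_right a)"
  proof (rule order_tendstoI)
    fix l assume "l < L"
    then have "l < ereal (deriv r y)" if "y \<in> dom_int" for y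
      using that unfolding L_def by (meson INF_lower less_le_trans)
    then show "eventually (\<lambda>y. l < ereal (deriv r y)) (at_right a)"
      using ev by (auto elim: eventually_mono)
  next
    fix u assume "L < u"
    then obtain y where y: "y \<in> dom_int" "ereal (deriv r y) < u"
      by (auto simp: L_def INF_less_iff)
    have "eventually (\<lambda>z. z < y) (at_right a)"
      using y(1) a by (auto simp: eventually_at_right_field)
    with ev show "eventually (\<lambda>z. ereal (deriv r z) < u) (at_right a)"
      by eventually_elim (rule le_less_trans[OF _ y(2)], use deriv_mono[OF _ y(1)] in auto)
  qed
  moreover from this have "Lim (at_right a) (\<lambda>y. ereal (deriv r y)) = L"
    by (intro tendsto_Lim) auto
  ultimately show "((\<lambda>y. ereal (deriv r y)) \<longlongrightarrow> ext_deriv \<phi> a) (at_right a)"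
    using a by (simp add: ext_deriv_def)
qed

lemma deriv_tendsto_hi:
  assumes a: "dom_hi \<phi> = ereal a"
  shows "((\<lambda>y. ereal (deriv r y)) \<longlongrightarrow> ext_deriv \<phi> a) (at_left a)"
    and "eventually (\<lambda>y. y \<in> dom_int) (at_left a)"
proof -
  obtain b where b: "b < a" "dom_lo \<phi> < ereal b"
    using ereal_dense2[OF endpoints] a by auto
  have ins: "y \<in> dom_int" if "b < y" "y < a" for y
    using that a b by (auto intro: less_trans[of _ "ereal b"])
  show ev: "eventually (\<lambda>y. y \<in> dom_int) (at_left a)"
    using b(1) ins by (auto simp: eventually_at_left_field)
  define L where "L = (SUP y\<in>dom_int. ereal (deriv r y))"
  have "((\<lambda>y. ereal (deriv r y)) \<longlongrightarrow> L) (at_left a)"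
  proof (rule order_tendstoI)
    fix u assume "L < u"
    then have "ereal (deriv r y) < u" if "y \<in> dom_int" for y
      using that unfolding L_def by (meson SUP_upper le_less_trans)
    then show "eventually (\<lambda>y. ereal (deriv r y) < u) (at_left a)"
      using ev by (auto elim: eventually_mono)
  next
    fix l assume "l < L"
    then obtain y where y: "y \<in> dom_int" "l < ereal (deriv r y)"
      by (auto simp: L_def less_SUP_iff)
    have "eventually (\<lambda>z. y < z) (at_left a)"
      using y(1) a by (auto simp: eventually_at_left_field)
    with ev show "eventually (\<lambda>z. l < ereal (deriv r z)) (at_left a)"
      by eventually_elim (rule less_le_trans[OF y(2)], use deriv_mono[OF y(1)] in auto)
  qed
  moreover from this have "Lim (at_left a) (\<lambda>y. ereal (deriv r y)) = L"
    by (intro tendsto_Lim) auto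
  \<comment> \<open>The definition of \<open>ext_deriv\<close> tests for the lower endpoint first.\<close>
  moreover have "dom_lo \<phi> \<noteq> ereal a" using endpoints a by auto
  ultimately show "((\<lambda>y. ereal (deriv r y)) \<longlongrightarrow> ext_deriv \<phi> a) (at_left a)"
    using a by (simp add: ext_deriv_def)
qed

text \<open>The tangent inequality survives the passage to an endpoint: both of its sides converge as the
  point of tangency tends to \<open>x\<close>. Closedness of \<open>\<phi>\<close> supplies the convergence of the values.\<close>

lemma tangent_limit:
  assumes F: "F \<noteq> bot" and ev: "eventually (\<lambda>y. y \<in> dom_int) F"
    and y: "((\<lambda>y. y) \<longlongrightarrow> x) F" and phi: "(\<phi> \<longlongrightarrow> \<phi> x) F"
    and t: "((\<lambda>y. ereal (deriv r y)) \<longlongrightarrow> ereal t) F"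
    and x: "x \<in> edom \<phi>" and z: "z \<in> edom \<phi>"
  shows "t * (z - x) \<le> r z - r x"
proof (rule tendsto_le[OF F])
  have "(r \<longlongrightarrow> r x) F"
    using phi edomD[OF x] by (intro tendsto_enn2real) auto
  then show "((\<lambda>y. r z - r y) \<longlongrightarrow> r z - r x) F"
    by (intro tendsto_diff tendsto_const)
  have "((\<lambda>y. deriv r y) \<longlongrightarrow> t) F" using t by simp
  then show "((\<lambda>y. deriv r y * (z - y)) \<longlongrightarrow> t * (z - x)) F"
    using y by (intro tendsto_intros)
  show "eventually (\<lambda>y. deriv r y * (z - y) \<le> r z - r y) F"
    using ev by eventually_elim (rule tangent_inside[OF _ z])
qed

lemma edom_cases:
  assumes "x \<in> edom \<phi>"
  obtains "x \<in> dom_int" | "dom_lo \<phi> = ereal x" | "dom_hi \<phi> = ereal x"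
  using edom_bounds[OF assms] by (auto simp: order.order_iff_strict)

lemma ext_deriv_inside: "x \<in> dom_int \<Longrightarrow> ext_deriv \<phi> x = ereal (deriv r x)"
  by (simp add: ext_deriv_def)

lemma ext_deriv_subgradient:
  assumes x: "x \<in> edom \<phi>" and t: "ext_deriv \<phi> x = ereal t" and z: "z \<in> edom \<phi>"
  shows "t * (z - x) \<le> r z - r x"
  using x
proof (cases rule: edom_cases)
  case 1
  then show ?thesis using tangent_inside[OF 1 z] t by (simp add: ext_deriv_inside)
next
  case 2
  show ?thesis
    using divergence_fun 2 deriv_tendsto_lo[OF 2] t x z
    by (intro tangent_limit[of "at_right x"]) (auto simp: divergence_fun_def closed_fun_def)
next
  case 3
  show ?thesis
    using divergence_fun 3 deriv_tendsto_hi[OF 3] t x z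
    by (intro tangent_limit[of "at_left x"]) (auto simp: divergence_fun_def closed_fun_def)
qed

lemma Fenchel_equality_ext_deriv:
  assumes "x \<in> edom \<phi>" "ext_deriv \<phi> x = ereal t"
  shows "conjugate \<phi> t = ereal (t * x - r x)"
  using assms ext_deriv_subgradient by (simp add: Fenchel_equality_iff)

lemma subgradient_inside_unique:
  assumes x: "x \<in> dom_int" and t: "\<And>z. z \<in> edom \<phi> \<Longrightarrow> t * (z - x) \<le> r z - r x"
  shows "t = deriv r x"
proof -
  obtain d where d: "0 < d" "\<And>y. \<bar>x - y\<bar> < d \<Longrightarrow> y \<in> dom_int"
    using open_between_endpoints[of \<phi>] x unfolding open_dist
    by (metis (no_types, lifting) abs_minus_commute dist_real_def)
  \<comment> \<open>The function \<open>z \<mapsto> r z - t * z\<close> has a local minimum at \<open>x\<close>.\<close>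
  have "((\<lambda>z. r z - t * z) has_real_derivative deriv r x - t) (at x)"
    using has_derivative_inside[OF x] by (auto intro!: derivative_eq_intros)
  moreover have "\<forall>y. \<bar>x - y\<bar> < d \<longrightarrow> r x - t * x \<le> r y - t * y"
    using t d(2) inside_edom by (auto simp: algebra_simps)
  ultimately have "deriv r x - t = 0"
    using d(1) DERIV_local_min by blast
  then show ?thesis by simp
qed

text \<open>For essentially smooth \<open>\<phi>\<close> the derivative is infinite at the endpoints, so a finite value of
  it forces \<open>x\<close> into the open interval, where differentiability leaves only one subgradient.\<close>

lemma Fenchel_equality_unique:
  assumes smooth: "essentially_smooth \<phi>" and x: "x \<in> edom \<phi>"
    and t: "ext_deriv \<phi> x = ereal t" and s: "conjugate \<phi> s = ereal (s * x - r x)"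
  shows "s = t"
  using x
proof (cases rule: edom_cases)
  case 1
  have "s = deriv r x"
    using s by (intro subgradient_inside_unique[OF 1]) (simp add: Fenchel_equality_iff[OF x])
  then show ?thesis using t by (simp add: ext_deriv_inside[OF 1])
qed (use smooth t in \<open>auto simp: essentially_smooth_def\<close>)

end

section \<open>Integrating the Fenchel inequality\<close>

lemma ext_integral_eq_integral:
  assumes c: "integrable M c" and h: "AE x in M. h x = ereal (c x)"
  shows "ext_integral M h = ereal (\<integral>x. c x \<partial>M)"
proof -
  have "(\<integral>\<^sup>+x. e2ennreal (h x) \<partial>M) = (\<integral>\<^sup>+x. ennreal (c x) \<partial>M)"
    "(\<integral>\<^sup>+x. e2ennreal (- h x) \<partial>M) = (\<integral>\<^sup>+x. ennreal (- c x) \<partial>M)"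
    using h by (auto intro!: nn_integral_cong_AE)
  moreover have "enn2ereal e = ereal (enn2real e)" if "e \<noteq> \<infinity>" for e
    using that by (cases e) auto
  ultimately show ?thesis
    using c by (simp add: ext_integral_def real_integrable_def real_lebesgue_integral_def)
qed

text \<open>The minorant bounds the negative part of \<open>h\<close>, so only the positive part can have infinite
  integral, and \<open>\<infinity> - \<infinity>\<close> never arises.\<close>

lemma ext_integral_minorant_cases:
  assumes h [measurable]: "h \<in> borel_measurable M" and k: "integrable M k"
    and le: "AE x in M. ereal (k x) \<le> h x"
  obtains (infinite) "ext_integral M h = \<infinity>"
    | (finite) c where "integrable M c" "AE x in M. h x = ereal (c x)"
proof (cases "(\<integral>\<^sup>+x. e2ennreal (h x) \<partial>M) = \<infinity>")
  case True
  have "(\<integral>\<^sup>+x. e2ennreal (- h x) \<partial>M) \<le> (\<integral>\<^sup>+x. ennreal (- k x) \<partial>M)"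
    using le
  proof (intro nn_integral_mono_AE, eventually_elim)
    case (elim x)
    then have "- h x \<le> ereal (- k x)" by (cases "h x") auto
    then show ?case using e2ennreal_mono by fastforce
  qed
  moreover have "(\<integral>\<^sup>+x. ennreal (- k x) \<partial>M) < \<infinity>"
    using k by (simp add: real_integrable_def top.not_eq_extremum)
  ultimately have "enn2ereal (\<integral>\<^sup>+x. e2ennreal (- h x) \<partial>M) \<noteq> \<infinity>"
    by auto
  then have "ext_integral M h = \<infinity>" using True by (simp add: ext_integral_def)
  then show thesis by (rule infinite)
next
  case False
  have "AE x in M. e2ennreal (h x) \<noteq> \<infinity>"
    using False by (intro nn_integral_PInf_AE) auto
  with le have hc: "AE x in M. h x = ereal (real_of_ereal (h x))"
  proof eventually_elim
    case (elim x)
    then show ?case by (cases "h x") auto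
  qed
  have "integrable M (\<lambda>x. real_of_ereal (h x))"
    unfolding real_integrable_def
  proof (intro conjI)
    have "(\<integral>\<^sup>+x. ennreal (real_of_ereal (h x)) \<partial>M) = (\<integral>\<^sup>+x. e2ennreal (h x) \<partial>M)"
      using hc by (intro nn_integral_cong_AE) (auto elim!: eventually_mono, metis e2ennreal_ereal)
    with False show "(\<integral>\<^sup>+x. ennreal (real_of_ereal (h x)) \<partial>M) \<noteq> \<infinity>" by simp
    have "(\<integral>\<^sup>+x. ennreal (- real_of_ereal (h x)) \<partial>M) \<le> (\<integral>\<^sup>+x. ennreal (- k x) \<partial>M)"
      using le hc
    proof (intro nn_integral_mono_AE, eventually_elim)
      case (elim x)
      then show ?case by (cases "h x") (auto intro: ennreal_leI)
    qed
    then show "(\<integral>\<^sup>+x. ennreal (- real_of_ereal (h x)) \<partial>M) \<noteq> \<infinity>"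
      using k by (auto simp: real_integrable_def top_unique)
  qed simp
  then show thesis using hc by (rule finite)
qed

text \<open>If the integral of \<open>h\<close> is infinite, the inequality is strict and \<open>h\<close> cannot agree with \<open>k\<close>
  almost everywhere; otherwise \<open>h\<close> is almost everywhere a real integrable function, and a nonnegative
  function with integral zero vanishes almost everywhere.\<close>

lemma integral_le_ext_integral:
  assumes h: "h \<in> borel_measurable M" and k: "integrable M k"
    and le: "AE x in M. ereal (k x) \<le> h x"
  shows "ereal (\<integral>x. k x \<partial>M) \<le> ext_integral M h"
    and "ext_integral M h = ereal (\<integral>x. k x \<partial>M) \<longleftrightarrow> (AE x in M. h x = ereal (k x))"
proof -
  have "ereal (\<integral>x. k x \<partial>M) \<le> ext_integral M h \<and>
    (ext_integral M h = ereal (\<integral>x. k x \<partial>M) \<longrightarrow> (AE x in M. h x = ereal (k x)))"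
    using h k le
  proof (cases rule: ext_integral_minorant_cases)
    case (finite c)
    note E = ext_integral_eq_integral[OF finite]
    have kc: "AE x in M. k x \<le> c x"
      using le finite(2) by eventually_elim simp
    have "AE x in M. h x = ereal (k x)" if "(\<integral>x. c x \<partial>M) = (\<integral>x. k x \<partial>M)"
    proof -
      have "(\<integral>x. c x - k x \<partial>M) = 0" using that finite(1) k by simp
      then have "AE x in M. c x - k x = 0"
        using finite(1) k kc by (subst (asm) integral_nonneg_eq_0_iff_AE) auto
      then show ?thesis using finite(2) by eventually_elim simp
    qed
    then show ?thesis
      unfolding E using integral_mono_AE[OF k finite(1) kc] by simp
  qed simp
  then show "ereal (\<integral>x. k x \<partial>M) \<le> ext_integral M h"
    and "ext_integral M h = ereal (\<integral>x. k x \<partial>M) \<longleftrightarrow> (AE x in M. h x = ereal (k x))"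
    using ext_integral_eq_integral[OF k] by blast+
qed

locale finite_divergence = differentiable_divergence +
  fixes P :: "'a measure" and Q :: "'a set \<Rightarrow> real" and F :: "('a \<Rightarrow> real) set"
  assumes P: "prob_space P" and F: "F \<subseteq> borel_measurable P" and Q: "Q \<in> M_class P F"
    and finite: "phi_divergence \<phi> Q P < \<infinity>"
begin

abbreviation g :: "'a \<Rightarrow> real" where "g \<equiv> signed_RN_deriv P Q"

lemma ac: "Q \<in> ac_signed_measures P"
  using finite by (auto simp: phi_divergence_def split: if_splits)

lemma g: "integrable P g" "\<And>A. A \<in> sets P \<Longrightarrow> Q A = (LINT x:A|P. g x)"
  using signed_RN_deriv[OF _ ac] prob_space_imp_sigma_finite[OF P] by auto

lemma g_measurable [measurable]: "g \<in> borel_measurable P"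
  using g(1) by auto

lemma AE_edom: "AE x in P. g x \<in> edom \<phi>"
proof -
  have "AE x in P. \<phi> (g x) \<noteq> \<infinity>"
    using finite ac by (intro nn_integral_PInf_AE) (auto simp: phi_divergence_def)
  then show ?thesis by (auto simp: edom_def top.not_eq_extremum elim: eventually_mono)
qed

lemma divergence_integral:
  "integrable P (\<lambda>x. r (g x))" "phi_divergence \<phi> Q P = ennreal (\<integral>x. r (g x) \<partial>P)"
proof -
  have eq: "phi_divergence \<phi> Q P = (\<integral>\<^sup>+x. ennreal (r (g x)) \<partial>P)"
    using AE_edom ac unfolding phi_divergence_def
    by (auto intro!: nn_integral_cong_AE elim!: eventually_mono simp: edomD[symmetric])
  show int: "integrable P (\<lambda>x. r (g x))"
    using finite unfolding eq by (intro integrableI_nonneg) auto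
  show "phi_divergence \<phi> Q P = ennreal (\<integral>x. r (g x) \<partial>P)"
    unfolding eq using int by (intro nn_integral_eq_integral) auto
qed

text \<open>The integral of \<open>f * g - r \<circ> g\<close> is \<open>\<integral>f dQ\<close> minus the divergence. By the Fenchel inequality
  this function is an integrable minorant of the conjugate along \<open>f\<close>, which gives weak duality and
  reduces equality of the integrals to almost sure equality of the integrands.\<close>

lemma weak_duality:
  assumes f: "f \<in> F"
  shows "dual_objective \<phi> Q P f \<le> enn2ereal (phi_divergence \<phi> Q P)"
    and "dual_objective \<phi> Q P f = enn2ereal (phi_divergence \<phi> Q P) \<longleftrightarrow>
      (AE x in P. conjugate \<phi> (f x) = ereal (f x * g x - r (g x)))"
proof -
  have [measurable]: "f \<in> borel_measurable P" using f F by auto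
  have "(\<integral>\<^sup>+x. ennreal \<bar>f x\<bar> \<partial>total_variation P Q) < \<infinity>"
    using f Q by (auto simp: M_class_def)
  note fg = signed_integral_eq_lebesgue_integral[OF g _ this, simplified]
  let ?s = "signed_integral P Q f" and ?d = "\<integral>x. r (g x) \<partial>P"
  let ?E = "ext_integral P (\<lambda>x. conjugate \<phi> (f x))" and ?k = "\<lambda>x. f x * g x - r (g x)"
  have h: "(\<lambda>x. conjugate \<phi> (f x)) \<in> borel_measurable P"
    using conjugate_borel_measurable by measurable
  have k: "integrable P ?k" "(\<integral>x. ?k x \<partial>P) = ?s - ?d"
    using fg divergence_integral(1) by auto
  have le: "AE x in P. ereal (?k x) \<le> conjugate \<phi> (f x)"
    using AE_edom by eventually_elim (rule Fenchel_inequality)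
  note E = integral_le_ext_integral[OF h k(1) le, unfolded k(2)]
  have d: "enn2ereal (phi_divergence \<phi> Q P) = ereal ?d"
    by (simp add: divergence_integral(2) integral_nonneg)
  show "dual_objective \<phi> Q P f \<le> enn2ereal (phi_divergence \<phi> Q P)"
    unfolding d dual_objective_def using E(1) by (cases ?E) auto
  show "dual_objective \<phi> Q P f = enn2ereal (phi_divergence \<phi> Q P) \<longleftrightarrow>
      (AE x in P. conjugate \<phi> (f x) = ereal (?k x))"
    unfolding d dual_objective_def E(2)[symmetric] by (cases ?E) auto
qed

end

theorem theorem4p5:
  fixes P :: "'a measure" and \<phi> :: "real \<Rightarrow> ennreal" and F :: "('a \<Rightarrow> real) set"
    and Q :: "'a set \<Rightarrow> real" and fbar :: "'a \<Rightarrow> real"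
  assumes "prob_space P"
    and "divergence_fun \<phi>"
    and "differentiable_fun \<phi>"
    and "F \<subseteq> borel_measurable P"
    and "Q \<in> M_class P F"
    and "phi_divergence \<phi> Q P < \<infinity>"
    and "fbar \<in> F"
    and "AE x in P. ereal (fbar x) = ext_deriv \<phi> (signed_RN_deriv P Q x)"
  shows "enn2ereal (phi_divergence \<phi> Q P) = (SUP f\<in>F. dual_objective \<phi> Q P f) \<and>
         dual_optimal \<phi> Q P F fbar \<and>
         (essentially_smooth \<phi> \<longrightarrow>
            (\<forall>f. dual_optimal \<phi> Q P F f \<longrightarrow> (AE x in P. f x = fbar x)))"
proof -
  interpret finite_divergence \<phi> P Q F
    using assms by (intro finite_divergence.intro differentiable_divergence.intro
        finite_divergence_axioms.intro)
  note fbar = assms(7) and fbar_deriv = assms(8)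
  have "AE x in P. conjugate \<phi> (fbar x) = ereal (fbar x * g x - r (g x))"
    using AE_edom fbar_deriv by eventually_elim (simp add: Fenchel_equality_ext_deriv)
  then have attained: "dual_objective \<phi> Q P fbar = enn2ereal (phi_divergence \<phi> Q P)"
    using weak_duality(2)[OF fbar] by simp
  have sup: "enn2ereal (phi_divergence \<phi> Q P) = (SUP f\<in>F. dual_objective \<phi> Q P f)"
    using weak_duality(1) fbar attained by (intro antisym SUP_least SUP_upper2[OF fbar]) auto
  have "AE x in P. f x = fbar x" if smooth: "essentially_smooth \<phi>" and f: "dual_optimal \<phi> Q P F f" for f
  proof -
    have "AE x in P. conjugate \<phi> (f x) = ereal (f x * g x - r (g x))"
      using f weak_duality(2)[of f] sup by (simp add: dual_optimal_def)
    with AE_edom fbar_deriv show ?thesis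
      by eventually_elim (metis Fenchel_equality_unique[OF smooth])
  qed
  with sup attained fbar show ?thesis by (simp add: dual_optimal_def)
qed

end
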